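(* Consider the problem of estimating the density of $Y_1$ under either Kullback-Leibler or reverse Kullback-Leibler loss, with the constraint $\theta_1-\theta_2\in A$. Set $r=\sigma_2^2/\sigma_1^2$, $W_1=(X_1-X_2)/(1+r)$, $W_2=(rX_1+X_2)/(1+r)$, $\mu_1=(\theta_1-\theta_2)/(1+r)$. For fixed $c>0$, consider the predictive densities $q_{\delta_\psi,c}\sim N_p(\delta_\psi,c\,\sigma_Y^2I_p)$, with $\delta_\psi$ an estimator of $\theta_1$ of the form $\delta_\psi(W_1,W_2)=W_2+\psi(W_1)$. Then $q_{\delta_{\psi_A},c}$ dominates $q_{\delta_{\psi_B},c}$ if and only if $\psi_A$ dominates $\psi_B$ as an estimator of $\mu_1$ under loss $\|\psi-\mu_1\|^2$, for $W_1\sim N_p\big(\mu_1,\frac{\sigma_1^2}{1+r}I_p\big)$ and the parametric restriction $(1+r)\mu_1\in A$.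
   Context: Model: $X=(X_1,X_2)$ and $Y_1$, with $X_1\sim N_p(\theta_1,\sigma_1^2I_p)$, $X_2\sim N_p(\theta_2,\sigma_2^2I_p)$, $Y_1\sim N_p(\theta_1,\sigma_Y^2I_p)$ independent, where $\sigma_1^2,\sigma_2^2,\sigma_Y^2>0$ are known and $\theta=(\theta_1,\theta_2)\in\mathbb{R}^{2p}$ satisfies $\theta_1-\theta_2\in A$ for a given $A\subset\mathbb{R}^p$. Let $q_{\theta_1}$ be the density of $Y_1$. A predictive density is a density $\hat q(\cdot;X)$ on $\mathbb{R}^p$ used to estimate $q_{\theta_1}$. Kullback-Leibler loss: $\int q_{\theta_1}(y)\log\frac{q_{\theta_1}(y)}{\hat q(y;x)}\,dy$. Reverse Kullback-Leibler loss: $\int \hat q(y;x)\log\frac{\hat q(y;x)}{q_{\theta_1}(y)}\,dy$. Risk is the expectation of the loss under the distribution of $X$ given $\theta$. A procedure dominates another if its risk is less than or equal for all parameter values in the restricted parameter space, with strict inequality for at least one. *)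

theory Defs
  imports "HOL-Probability.Probability"
begin

text \<open>The second argument is the variance \<open>v\<close> of the covariance matrix \<open>v I\<^sub>p\<close>, not a standard
  deviation (unlike \<^const>\<open>normal_density\<close>).\<close>

definition mvn_density :: "real^'n \<Rightarrow> real \<Rightarrow> real^'n \<Rightarrow> real" where
  "mvn_density m v y =
     (2 * pi * v) powr (- real CARD('n) / 2) * exp (- (norm (y - m))\<^sup>2 / (2 * v))"

definition mvn :: "real^'n \<Rightarrow> real \<Rightarrow> (real^'n) measure" where
  "mvn m v = density lborel (\<lambda>y. ennreal (mvn_density m v y))"

text \<open>For probability densities \<open>f\<close> and \<open>g\<close> the negative part of \<open>f log (f / g)\<close> is integrable and the
  integral is nonnegative, so the integral is either a nonnegative real or \<open>+\<infinity>\<close>; the latter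
  happens when \<open>g\<close> vanishes on a set of positive \<open>f\<close>-mass or the integrand is not integrable.
  The cases have to be told apart because of the conventions \<open>f / 0 = 0\<close> and \<open>ln 0 = 0\<close>, and
  because the Bochner integral of a non-integrable function is \<open>0\<close>.\<close>

definition kl_div :: "(real^'n \<Rightarrow> real) \<Rightarrow> (real^'n \<Rightarrow> real) \<Rightarrow> ennreal" where
  "kl_div f g =
     (if (AE y in lborel. g y = 0 \<longrightarrow> f y = 0) \<and> integrable lborel (\<lambda>y. f y * ln (f y / g y))
      then ennreal (\<integral>y. f y * ln (f y / g y) \<partial>lborel)
      else \<infinity>)"

definition KL_loss :: "(real^'n \<Rightarrow> real) \<Rightarrow> (real^'n \<Rightarrow> real) \<Rightarrow> ennreal" where
  "KL_loss q qhat = kl_div q qhat"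

definition reverse_KL_loss :: "(real^'n \<Rightarrow> real) \<Rightarrow> (real^'n \<Rightarrow> real) \<Rightarrow> ennreal" where
  "reverse_KL_loss q qhat = kl_div qhat q"

definition dominates :: "'t set \<Rightarrow> ('t \<Rightarrow> 'd \<Rightarrow> ennreal) \<Rightarrow> 'd \<Rightarrow> 'd \<Rightarrow> bool" where
  "dominates \<Theta> R d d' \<longleftrightarrow>
     (\<forall>\<theta>\<in>\<Theta>. R \<theta> d \<le> R \<theta> d') \<and> (\<exists>\<theta>\<in>\<Theta>. R \<theta> d < R \<theta> d')"

definition law_X :: "real \<Rightarrow> real \<Rightarrow> (real^'n) \<times> (real^'n) \<Rightarrow> ((real^'n) \<times> (real^'n)) measure" where
  "law_X \<sigma>1 \<sigma>2 \<theta> = mvn (fst \<theta>) (\<sigma>1\<^sup>2) \<Otimes>\<^sub>M mvn (snd \<theta>) (\<sigma>2\<^sup>2)"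

text \<open>Risk of a predictive density \<open>qhat x y\<close>, where \<open>x\<close> is the observed value of \<open>X\<close>. \<open>Y\<^sub>1\<close> enters
  only through its density. Losses are nonnegative, so the expectation is taken as a nonnegative
  integral and may be infinite.\<close>

definition predictive_risk ::
  "((real^'n \<Rightarrow> real) \<Rightarrow> (real^'n \<Rightarrow> real) \<Rightarrow> ennreal) \<Rightarrow> real \<Rightarrow> real \<Rightarrow> real
    \<Rightarrow> (real^'n) \<times> (real^'n) \<Rightarrow> ((real^'n) \<times> (real^'n) \<Rightarrow> real^'n \<Rightarrow> real) \<Rightarrow> ennreal" where
  "predictive_risk L \<sigma>1 \<sigma>2 \<sigma>Y \<theta> qhat =
     (\<integral>\<^sup>+ x. L (mvn_density (fst \<theta>) (\<sigma>Y\<^sup>2)) (qhat x) \<partial>law_X \<sigma>1 \<sigma>2 \<theta>)"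

definition squared_error_risk ::
  "real \<Rightarrow> real^'n \<Rightarrow> (real^'n \<Rightarrow> real^'n) \<Rightarrow> ennreal" where
  "squared_error_risk v \<mu> \<psi> = (\<integral>\<^sup>+ w. ennreal ((norm (\<psi> w - \<mu>))\<^sup>2) \<partial>mvn \<mu> v)"

definition W1 :: "real \<Rightarrow> (real^'n) \<times> (real^'n) \<Rightarrow> real^'n" where
  "W1 r x = (1 / (1 + r)) *\<^sub>R (fst x - snd x)"

definition W2 :: "real \<Rightarrow> (real^'n) \<times> (real^'n) \<Rightarrow> real^'n" where
  "W2 r x = (1 / (1 + r)) *\<^sub>R (r *\<^sub>R fst x + snd x)"

definition delta ::
  "real \<Rightarrow> (real^'n \<Rightarrow> real^'n) \<Rightarrow> (real^'n) \<times> (real^'n) \<Rightarrow> real^'n" where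
  "delta r \<psi> x = W2 r x + \<psi> (W1 r x)"

definition q_plug ::
  "real \<Rightarrow> real \<Rightarrow> ((real^'n) \<times> (real^'n) \<Rightarrow> real^'n) \<Rightarrow> (real^'n) \<times> (real^'n) \<Rightarrow> real^'n \<Rightarrow> real" where
  "q_plug \<sigma>Y c \<delta> x = mvn_density (\<delta> x) (c * \<sigma>Y\<^sup>2)"

end

theory Submission imports Defs begin

text \<open>
  Between two spherical normal densities, the Kullback-Leibler divergence is a constant that depends
  only on the two variances, plus a positive multiple of the squared distance of the means
  (\<open>kl_div_mvn_density\<close>). The variances of \<open>q\<^bsub>\<delta>,c\<^esub>\<close> and of the true density are fixed, so under both
  losses the loss of \<open>q\<^bsub>\<delta>,c\<^esub>\<close> is \<open>k + a \<parallel>\<delta> - \<theta>1\<parallel>\<^sup>2\<close>; only the constants \<open>k \<ge> 0\<close> and \<open>a > 0\<close> depend on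
  which of the two losses is used.

  It remains to compare squared-error risks. Because \<open>r = \<sigma>2\<^sup>2 / \<sigma>1\<^sup>2\<close>, the vectors \<open>W1\<close> and \<open>W2\<close> are
  uncorrelated, hence independent normals, with means \<open>\<mu>1 = W1(\<theta>)\<close> and \<open>\<mu>2 = W2(\<theta>)\<close> and variances
  \<open>\<sigma>1\<^sup>2 / (1 + r)\<close> and \<open>r \<sigma>1\<^sup>2 / (1 + r)\<close> (\<open>nn_integral_law_X_W1_W2\<close>), and \<open>\<theta>1 = \<mu>1 + \<mu>2\<close>. Thus
  \<open>\<delta> - \<theta>1 = (W2 - \<mu>2) + (\<psi>(W1) - \<mu>1)\<close> is a centred vector plus one that is independent of it, and
  integrating over \<open>W2\<close> first gives
  \<open>E \<parallel>\<delta> - \<theta>1\<parallel>\<^sup>2 = p r \<sigma>1\<^sup>2 / (1 + r) + E \<parallel>\<psi>(W1) - \<mu>1\<parallel>\<^sup>2\<close>.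

  The predictive risk at \<open>\<theta>\<close> is therefore a fixed strictly increasing affine function of the
  squared-error risk of \<open>\<psi>\<close> at \<open>\<mu>1\<close> (\<open>predictive_risk_affine\<close>), and \<open>\<theta> \<mapsto> \<mu>1\<close> maps the restricted parameter
  space of the first problem onto that of the second (\<open>W1_image_constraint\<close>). Domination in one problem
  is then domination in the other. Either risk may be infinite, which is harmless since the affine
  function has a finite constant and a finite positive slope.\<close>

section \<open>Spherical normal densities as products\<close>

lemma mvn_density_pos: "v > 0 \<Longrightarrow> mvn_density m v y > 0"
  by (simp add: mvn_density_def)

lemma mvn_density_measurable [measurable]: "mvn_density m v \<in> borel_measurable borel"
  unfolding mvn_density_def by measurable

lemma norm_power2_eq_sum_Basis: "(norm (x::real^'n))\<^sup>2 = (\<Sum>b\<in>Basis. (x \<bullet> b)\<^sup>2)"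
  unfolding power2_norm_eq_inner by (subst euclidean_inner) (simp add: power2_eq_square)

lemma gaussian_constant_eq:
  assumes "v > 0"
  shows "(2 * pi * v) powr (- real p / 2) = (1 / sqrt (2 * pi * v)) ^ p"
proof -
  have pos: "2 * pi * v > 0" using assms by simp
  have "(1 / sqrt (2 * pi * v)) ^ p = ((2 * pi * v) powr (- (1/2))) ^ p"
    using pos by (simp add: powr_minus powr_half_sqrt inverse_eq_divide)
  also have "\<dots> = (2 * pi * v) powr (- real p / 2)"
    using pos by (subst powr_power) (auto simp: divide_simps)
  finally show ?thesis ..
qed

text \<open>The factorization over the standard basis reduces every integral below to one-dimensional
  normal moments, by Tonelli's theorem for \<^const>\<open>lborel\<close>.\<close>

lemma mvn_density_eq_prod_normal_density:
  fixes m :: "real^'n"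
  assumes "v > 0"
  shows "mvn_density m v y = (\<Prod>b\<in>Basis. normal_density (m \<bullet> b) (sqrt v) (y \<bullet> b))"
proof -
  have "(\<Prod>b\<in>Basis. normal_density (m \<bullet> b) (sqrt v) (y \<bullet> b))
     = (1 / sqrt (2 * pi * v)) ^ CARD('n)
       * exp (\<Sum>b\<in>(Basis :: (real^'n) set). - ((y - m) \<bullet> b)\<^sup>2 / (2 * v))"
    using assms by (simp add: normal_density_def prod_dividef power_divide exp_sum inner_diff_left)
  also have "(\<Sum>b\<in>(Basis :: (real^'n) set). - ((y - m) \<bullet> b)\<^sup>2 / (2 * v))
     = - (norm (y - m))\<^sup>2 / (2 * v)"
    by (simp add: norm_power2_eq_sum_Basis sum_negf sum_divide_distrib)
  finally show ?thesis
    using gaussian_constant_eq [OF assms, of "CARD('n)"] by (simp add: mvn_density_def)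
qed

lemma nn_integral_normal_density:
  assumes "s > 0"
  shows "(\<integral>\<^sup>+x. ennreal (normal_density a s x) \<partial>lborel) = 1"
  using assms
  by (subst nn_integral_eq_integral) (auto simp: integral_normal_density)

text \<open>Expand \<open>(x - b)\<^sup>2\<close> around the mean \<open>a\<close>: the linear term is an odd central moment and vanishes.\<close>

lemma nn_integral_normal_density_second_moment:
  assumes "s > 0"
  shows "(\<integral>\<^sup>+x. ennreal (normal_density a s x * (x - b)\<^sup>2) \<partial>lborel)
       = ennreal (s\<^sup>2 + (a - b)\<^sup>2)"
proof -
  have eq: "(\<lambda>x. normal_density a s x * (x - b)\<^sup>2) = (\<lambda>x. normal_density a s x * (x - a)^(2*1)
      + 2 * (a - b) * (normal_density a s x * (x - a)^(2*0+1)) + (a - b)\<^sup>2 * normal_density a s x)"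
    by (rule ext) (simp add: power2_eq_square algebra_simps)
  have "has_bochner_integral lborel (\<lambda>x. normal_density a s x * (x - b)\<^sup>2)
      (fact (2 * 1) / ((2 / s\<^sup>2)^1 * fact 1) + 2 * (a - b) * 0 + (a - b)\<^sup>2 * 1)"
    unfolding eq
    using assms normal_moment_even [of s a 1] normal_moment_odd [of s a 0]
    by (intro has_bochner_integral_add has_bochner_integral_mult_right)
       (auto simp: has_bochner_integral_iff integral_normal_density)
  then have "has_bochner_integral lborel (\<lambda>x. normal_density a s x * (x - b)\<^sup>2) (s\<^sup>2 + (a - b)\<^sup>2)"
    by (simp add: fact_numeral)
  then show ?thesis
    by (subst nn_integral_eq_integral) (auto simp: has_bochner_integral_iff)
qed

section \<open>Moments of the spherical normal distribution\<close>

lemma nn_integral_mvn_density: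
  fixes m :: "real^'n"
  assumes "v > 0"
  shows "(\<integral>\<^sup>+y. ennreal (mvn_density m v y) \<partial>lborel) = 1"
proof -
  have "(\<integral>\<^sup>+y. ennreal (mvn_density m v y) \<partial>lborel)
    = (\<integral>\<^sup>+y. (\<Prod>b\<in>Basis. ennreal (normal_density (m \<bullet> b) (sqrt v) (y \<bullet> b))) \<partial>lborel)"
    by (simp add: mvn_density_eq_prod_normal_density [OF assms] prod_ennreal)
  also have "\<dots> = (\<Prod>b\<in>(Basis :: (real^'n) set).
      \<integral>\<^sup>+x. ennreal (normal_density (m \<bullet> b) (sqrt v) x) \<partial>lborel)"
    by (rule nn_integral_lborel_prod) auto
  also have "\<dots> = 1"
    using assms by (simp add: nn_integral_normal_density)
  finally show ?thesis .
qed

lemma nn_integral_mvn_density_coordinate_second_moment: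
  fixes m a i :: "real^'n"
  assumes "v > 0" and "i \<in> Basis"
  shows "(\<integral>\<^sup>+y. ennreal (mvn_density m v y * ((y - a) \<bullet> i)\<^sup>2) \<partial>lborel)
       = ennreal (v + ((m - a) \<bullet> i)\<^sup>2)"
proof -
  \<comment> \<open>The factor \<open>((y - a) \<bullet> i)\<^sup>2\<close> is absorbed into coordinate \<open>i\<close>, so the integrand stays a product.\<close>
  define f where "f b x = normal_density (m \<bullet> b) (sqrt v) x * (if b = i then (x - a \<bullet> i)\<^sup>2 else 1)"
    for b x
  have f_nonneg: "f b x \<ge> 0" for b x
    by (simp add: f_def)
  have "mvn_density m v y * ((y - a) \<bullet> i)\<^sup>2 = (\<Prod>b\<in>Basis. f b (y \<bullet> b))" for y
    using assms
    by (simp add: f_def mvn_density_eq_prod_normal_density prod.distrib inner_diff_left)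
  then have "(\<integral>\<^sup>+y. ennreal (mvn_density m v y * ((y - a) \<bullet> i)\<^sup>2) \<partial>lborel)
    = (\<integral>\<^sup>+y. (\<Prod>b\<in>Basis. ennreal (f b (y \<bullet> b))) \<partial>lborel)"
    by (simp add: prod_ennreal f_nonneg)
  also have "\<dots> = (\<Prod>b\<in>(Basis :: (real^'n) set). \<integral>\<^sup>+x. ennreal (f b x) \<partial>lborel)"
    by (rule nn_integral_lborel_prod) (auto simp: f_def)
  also have "\<dots> = (\<Prod>b\<in>(Basis :: (real^'n) set).
      if b = i then ennreal (v + ((m - a) \<bullet> i)\<^sup>2) else 1)"
    using assms
    by (intro prod.cong)
       (simp_all add: f_def nn_integral_normal_density nn_integral_normal_density_second_moment
         inner_diff_left)
  also have "\<dots> = ennreal (v + ((m - a) \<bullet> i)\<^sup>2)"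
    using assms by simp
  finally show ?thesis .
qed

text \<open>The reference point \<open>a\<close> need not be the mean. With \<open>a = m\<close> and with \<open>a\<close> the mean of another normal
  this evaluates the Kullback-Leibler divergence; with \<open>a\<close> determined by \<open>W1\<close> it splits off the
  contribution of \<open>W2\<close> to the risk.\<close>

lemma nn_integral_mvn_density_second_moment:
  fixes m a :: "real^'n"
  assumes "v > 0"
  shows "(\<integral>\<^sup>+y. ennreal (mvn_density m v y * (norm (y - a))\<^sup>2) \<partial>lborel)
       = ennreal (real CARD('n) * v + (norm (m - a))\<^sup>2)"
proof -
  have "ennreal (mvn_density m v y * (norm (y - a))\<^sup>2)
      = (\<Sum>i\<in>Basis. ennreal (mvn_density m v y * ((y - a) \<bullet> i)\<^sup>2))" for y
    using mvn_density_pos [OF assms, of m y]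
    by (subst sum_ennreal) (auto simp: norm_power2_eq_sum_Basis sum_distrib_left)
  then have "(\<integral>\<^sup>+y. ennreal (mvn_density m v y * (norm (y - a))\<^sup>2) \<partial>lborel)
      = (\<Sum>i\<in>(Basis :: (real^'n) set). ennreal (v + ((m - a) \<bullet> i)\<^sup>2))"
    using assms
    by (simp add: nn_integral_sum nn_integral_mvn_density_coordinate_second_moment)
  also have "\<dots> = ennreal (\<Sum>i\<in>(Basis :: (real^'n) set). v + ((m - a) \<bullet> i)\<^sup>2)"
    using assms by (intro sum_ennreal) auto
  also have "\<dots> = ennreal (real CARD('n) * v + (norm (m - a))\<^sup>2)"
    by (simp add: sum.distrib norm_power2_eq_sum_Basis)
  finally show ?thesis .
qed

lemma has_bochner_integral_mvn_density:
  fixes m :: "real^'n"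
  assumes "v > 0"
  shows "has_bochner_integral lborel (mvn_density m v) 1"
  using nn_integral_mvn_density [OF assms, of m] mvn_density_pos [OF assms, of m]
  by (intro has_bochner_integral_nn_integral) (auto intro: less_imp_le)

lemma has_bochner_integral_mvn_density_second_moment:
  fixes m a :: "real^'n"
  assumes "v > 0"
  shows "has_bochner_integral lborel (\<lambda>y. mvn_density m v y * (norm (y - a))\<^sup>2)
           (real CARD('n) * v + (norm (m - a))\<^sup>2)"
  using nn_integral_mvn_density_second_moment [OF assms, of m a] mvn_density_pos [OF assms, of m] assms
  by (intro has_bochner_integral_nn_integral)
     (auto intro!: AE_I2 mult_nonneg_nonneg intro: less_imp_le)

lemma nn_integral_mvn:
  assumes [measurable]: "f \<in> borel_measurable borel"
  shows "(\<integral>\<^sup>+y. f y \<partial>mvn m v) = (\<integral>\<^sup>+y. ennreal (mvn_density m v y) * f y \<partial>lborel)"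
  unfolding mvn_def by (subst nn_integral_density) auto

lemma sets_mvn [simp, measurable_cong]: "sets (mvn m v) = sets borel"
  by (simp add: mvn_def)

lemma prob_space_mvn:
  assumes "v > 0"
  shows "prob_space (mvn m v)"
  using nn_integral_mvn_density [OF assms, of m]
  by (intro prob_spaceI) (simp add: mvn_def emeasure_density)

lemma nn_integral_mvn_second_moment:
  fixes m a :: "real^'n"
  assumes "v > 0"
  shows "(\<integral>\<^sup>+y. ennreal ((norm (y - a))\<^sup>2) \<partial>mvn m v)
       = ennreal (real CARD('n) * v + (norm (m - a))\<^sup>2)"
  using nn_integral_mvn_density_second_moment [OF assms, of m a] mvn_density_pos [OF assms, of m]
  by (simp add: nn_integral_mvn ennreal_mult less_imp_le)

section \<open>Divergence between spherical normals\<close>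

lemma ln_mvn_density_ratio:
  fixes m1 m2 y :: "real^'n"
  assumes "v1 > 0" and "v2 > 0"
  shows "ln (mvn_density m1 v1 y / mvn_density m2 v2 y)
       = real CARD('n) / 2 * ln (v2 / v1)
         + (norm (y - m2))\<^sup>2 / (2 * v2) - (norm (y - m1))\<^sup>2 / (2 * v1)"
  using assms mvn_density_pos [of v1 m1 y] mvn_density_pos [of v2 m2 y]
  by (simp add: mvn_density_def ln_mult ln_powr ln_div field_simps)

text \<open>The divergence between two \<open>p\<close>-dimensional spherical normals with a common mean.\<close>

definition kl_scale :: "nat \<Rightarrow> real \<Rightarrow> real \<Rightarrow> real" where
  "kl_scale p v1 v2 = real p / 2 * (v1 / v2 - 1 - ln (v1 / v2))"

lemma kl_scale_nonneg:
  assumes "v1 > 0" and "v2 > 0"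
  shows "kl_scale p v1 v2 \<ge> 0"
  using assms ln_le_minus_one [of "v1 / v2"] by (simp add: kl_scale_def)

text \<open>The log ratio of the densities is a constant plus a difference of two quadratics, so its mean under
  the first density follows from the second moment about \<open>m1\<close> and about \<open>m2\<close>. The terms
  are kept apart as extended nonnegative reals, ready to be integrated separately; nonnegativity of
  \<^const>\<open>kl_scale\<close> makes this possible.\<close>

lemma kl_div_mvn_density:
  fixes m1 m2 :: "real^'n"
  assumes v: "v1 > 0" "v2 > 0"
  shows "kl_div (mvn_density m1 v1) (mvn_density m2 v2)
       = ennreal (kl_scale CARD('n) v1 v2) + ennreal (1 / (2 * v2)) * ennreal ((norm (m1 - m2))\<^sup>2)"
proof -
  let ?f = "mvn_density m1 v1" and ?g = "mvn_density m2 v2"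
  let ?p = "real CARD('n)"
  have eq: "(\<lambda>y. ?f y * ln (?f y / ?g y))
     = (\<lambda>y. ?p / 2 * ln (v2 / v1) * ?f y + 1 / (2 * v2) * (?f y * (norm (y - m2))\<^sup>2)
            - 1 / (2 * v1) * (?f y * (norm (y - m1))\<^sup>2))"
    by (rule ext) (simp add: ln_mvn_density_ratio [OF v] algebra_simps)
  have "has_bochner_integral lborel (\<lambda>y. ?f y * ln (?f y / ?g y))
      (?p / 2 * ln (v2 / v1) * 1 + 1 / (2 * v2) * (?p * v1 + (norm (m1 - m2))\<^sup>2)
       - 1 / (2 * v1) * (?p * v1 + (norm (m1 - m1))\<^sup>2))"
    unfolding eq
    by (intro has_bochner_integral_add has_bochner_integral_diff has_bochner_integral_mult_right
        has_bochner_integral_mvn_density has_bochner_integral_mvn_density_second_moment v)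
  also have "?p / 2 * ln (v2 / v1) * 1 + 1 / (2 * v2) * (?p * v1 + (norm (m1 - m2))\<^sup>2)
       - 1 / (2 * v1) * (?p * v1 + (norm (m1 - m1))\<^sup>2)
     = kl_scale CARD('n) v1 v2 + 1 / (2 * v2) * (norm (m1 - m2))\<^sup>2"
    using v by (simp add: kl_scale_def ln_div field_simps)
  finally have int: "has_bochner_integral lborel (\<lambda>y. ?f y * ln (?f y / ?g y))
      (kl_scale CARD('n) v1 v2 + 1 / (2 * v2) * (norm (m1 - m2))\<^sup>2)" .
  have "?g y \<noteq> 0" for y
    using mvn_density_pos [OF v(2), of m2 y] by simp
  with int have "kl_div ?f ?g
      = ennreal (kl_scale CARD('n) v1 v2 + 1 / (2 * v2) * (norm (m1 - m2))\<^sup>2)"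
    by (simp add: kl_div_def has_bochner_integral_iff)
  also have "\<dots> = ennreal (kl_scale CARD('n) v1 v2)
      + ennreal (1 / (2 * v2)) * ennreal ((norm (m1 - m2))\<^sup>2)"
    using v kl_scale_nonneg [OF v]
    by (simp only: ennreal_plus ennreal_mult [symmetric] zero_le_power2 mult_nonneg_nonneg
        divide_nonneg_pos zero_le_one mult_pos_pos zero_less_numeral)
  finally show ?thesis .
qed

section \<open>Independence of the rotated variables\<close>

lemma fst_eq_W1_plus_W2:
  assumes "1 + r \<noteq> 0"
  shows "fst x = W1 r x + W2 r x"
proof -
  have "W1 r x + W2 r x = (1 / (1 + r)) *\<^sub>R ((1 + r) *\<^sub>R fst x)"
    by (simp add: W1_def W2_def scaleR_right_distrib [symmetric] algebra_simps)
  then show ?thesis using assms by simp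
qed

lemma snd_eq_W2_minus_W1:
  assumes "1 + r \<noteq> 0"
  shows "snd x = W2 r x - r *\<^sub>R W1 r x"
proof -
  have "snd x = fst x - (1 + r) *\<^sub>R W1 r x"
    using assms by (simp add: W1_def)
  also have "\<dots> = W2 r x - r *\<^sub>R W1 r x"
    by (subst fst_eq_W1_plus_W2 [OF assms]) (simp add: scaleR_left_distrib)
  finally show ?thesis .
qed

text \<open>Invert the rotation: \<open>x1 = w1 + w2\<close> and \<open>x2 = w2 - r w1\<close>, a linear map of determinant
  \<open>(1 + r)\<^sup>p\<close>. In the centred variables \<open>a = w1 - \<mu>1\<close> and \<open>b = w2 - \<mu>2\<close> the two exponents combine to
  \<open>\<parallel>a + b\<parallel>\<^sup>2 / v + \<parallel>b - r a\<parallel>\<^sup>2 / (r v) = (1 + r) \<parallel>a\<parallel>\<^sup>2 / v + (1 + r) \<parallel>b\<parallel>\<^sup>2 / (r v)\<close>,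
  and the determinant turns the normalizing constants into those of the new variances.\<close>

lemma mvn_density_prod_rotate:
  fixes \<mu>1 \<mu>2 w1 w2 :: "real^'n"
  assumes r: "r > 0" and v: "v > 0"
  shows "mvn_density (\<mu>1 + \<mu>2) v (w1 + w2) * mvn_density (\<mu>2 - r *\<^sub>R \<mu>1) (r * v) (w2 - r *\<^sub>R w1)
           * (1 + r) ^ CARD('n)
       = mvn_density \<mu>1 (v / (1 + r)) w1 * mvn_density \<mu>2 (r * v / (1 + r)) w2"
proof -
  let ?a = "w1 - \<mu>1" and ?b = "w2 - \<mu>2"
  let ?e = "- real CARD('n) / 2"
  have norms: "(norm (w1 + w2 - (\<mu>1 + \<mu>2)))\<^sup>2 / (2 * v)
        + (norm (w2 - r *\<^sub>R w1 - (\<mu>2 - r *\<^sub>R \<mu>1)))\<^sup>2 / (2 * (r * v))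
     = (norm ?a)\<^sup>2 / (2 * (v / (1 + r))) + (norm ?b)\<^sup>2 / (2 * (r * v / (1 + r)))"
  proof -
    have 1: "w1 + w2 - (\<mu>1 + \<mu>2) = ?a + ?b"
      and 2: "w2 - r *\<^sub>R w1 - (\<mu>2 - r *\<^sub>R \<mu>1) = ?b - r *\<^sub>R ?a"
      by (simp_all add: algebra_simps)
    have 3: "(norm (a + b))\<^sup>2 = (norm a)\<^sup>2 + 2 * (a \<bullet> b) + (norm b)\<^sup>2" for a b :: "real^'n"
      unfolding power2_norm_eq_inner by (simp add: inner_add inner_commute)
    have 4: "(norm (b - r *\<^sub>R a))\<^sup>2 = (norm b)\<^sup>2 - 2 * r * (a \<bullet> b) + r\<^sup>2 * (norm a)\<^sup>2"
      for a b :: "real^'n"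
      unfolding power2_norm_eq_inner
      by (simp add: inner_diff_left inner_diff_right inner_commute right_diff_distrib power2_eq_square)
    \<comment> \<open>The two mixed terms cancel: \<open>r v\<close> is the variance for which they do, and this
      cancellation is the uncorrelatedness of the rotated variables.\<close>
    show ?thesis
      unfolding 1 2 3 4 using r v by (simp add: field_simps power2_eq_square)
  qed
  have const: "(2 * pi * v) powr ?e * (2 * pi * (r * v)) powr ?e * (1 + r) ^ CARD('n)
      = (2 * pi * (v / (1 + r))) powr ?e * (2 * pi * (r * v / (1 + r))) powr ?e"
  proof -
    have "(1 + r) ^ CARD('n) = (1 + r) powr real CARD('n)"
      using r by (simp add: powr_realpow)
    also have "\<dots> = inverse ((1 + r) powr ?e) * inverse ((1 + r) powr ?e)"
      using r by (simp add: powr_minus [symmetric] powr_add [symmetric])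
    finally have pow: "(1 + r) ^ CARD('n) = inverse ((1 + r) powr ?e) * inverse ((1 + r) powr ?e)" .
    have scale: "(2 * pi * (x / (1 + r))) powr ?e = (2 * pi * x) powr ?e / (1 + r) powr ?e" for x
      by (simp only: times_divide_eq_right powr_divide)
    show ?thesis
      unfolding pow scale by (simp only: divide_inverse mult_ac)
  qed
  have "mvn_density (\<mu>1 + \<mu>2) v (w1 + w2) * mvn_density (\<mu>2 - r *\<^sub>R \<mu>1) (r * v) (w2 - r *\<^sub>R w1)
           * (1 + r) ^ CARD('n)
     = ((2 * pi * v) powr ?e * (2 * pi * (r * v)) powr ?e * (1 + r) ^ CARD('n))
       * exp (- ((norm (w1 + w2 - (\<mu>1 + \<mu>2)))\<^sup>2 / (2 * v)
        + (norm (w2 - r *\<^sub>R w1 - (\<mu>2 - r *\<^sub>R \<mu>1)))\<^sup>2 / (2 * (r * v))))"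
    by (simp only: mvn_density_def minus_add_distrib minus_divide_left exp_add mult_ac)
  also have "\<dots> = mvn_density \<mu>1 (v / (1 + r)) w1 * mvn_density \<mu>2 (r * v / (1 + r)) w2"
    unfolding norms const
    by (simp only: mvn_density_def minus_add_distrib minus_divide_left exp_add mult_ac)
  finally show ?thesis .
qed

lemma nn_integral_lborel_affine:
  fixes t :: "real^'n"
  assumes [measurable]: "f \<in> borel_measurable borel" and "c > 0"
  shows "(\<integral>\<^sup>+x. f x \<partial>lborel) = (\<integral>\<^sup>+x. ennreal (c ^ CARD('n)) * f (t + c *\<^sub>R x) \<partial>lborel)"
  using assms(2)
  by (subst lborel_affine [of c t]) (simp_all add: nn_integral_density nn_integral_distr)

text \<open>This says that under \<^const>\<open>law_X\<close> the pair \<open>(W1, W2)\<close> has the product law of two spherical normals.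
  The change of variables is a composition of two shears and a scaling, each acting on one block:
  for fixed \<open>x2\<close> substitute \<open>x1 = x2 + (1 + r) w1\<close>, then exchange the integrals and, for
  fixed \<open>w1\<close>, substitute \<open>x2 = w2 - r w1\<close>. Only affine maps of a single copy of the space and Tonelli's
  theorem are involved.\<close>

lemma nn_integral_law_X_W1_W2:
  fixes \<theta> :: "(real^'n) \<times> (real^'n)" and F :: "(real^'n) \<times> (real^'n) \<Rightarrow> ennreal"
  assumes s: "\<sigma>1 > 0" "\<sigma>2 > 0" and r_eq: "r = \<sigma>2\<^sup>2 / \<sigma>1\<^sup>2"
    and [measurable]: "F \<in> borel_measurable (borel \<Otimes>\<^sub>M borel)"
  shows "(\<integral>\<^sup>+x. F (W1 r x, W2 r x) \<partial>law_X \<sigma>1 \<sigma>2 \<theta>)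
       = (\<integral>\<^sup>+w1. \<integral>\<^sup>+w2. F (w1, w2) \<partial>mvn (W2 r \<theta>) (r * \<sigma>1\<^sup>2 / (1 + r))
            \<partial>mvn (W1 r \<theta>) (\<sigma>1\<^sup>2 / (1 + r)))"
proof -
  let ?v = "\<sigma>1\<^sup>2"
  have r: "r > 0" and v: "?v > 0" and rv: "r * ?v = \<sigma>2\<^sup>2" and r1: "1 + r > 0"
    using s by (simp_all add: r_eq add_pos_pos)
  define \<mu>1 \<mu>2 where "\<mu>1 = W1 r \<theta>" and "\<mu>2 = W2 r \<theta>"
  have \<theta>1: "fst \<theta> = \<mu>1 + \<mu>2" and \<theta>2: "snd \<theta> = \<mu>2 - r *\<^sub>R \<mu>1"
    using r1 fst_eq_W1_plus_W2 [of r \<theta>] snd_eq_W2_minus_W1 [of r \<theta>]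
    by (simp_all add: \<mu>1_def \<mu>2_def)
  define d1 d2 where "d1 x = ennreal (mvn_density (fst \<theta>) ?v x)"
    and "d2 x = ennreal (mvn_density (snd \<theta>) (r * ?v) x)" for x
  have [measurable]: "d1 \<in> borel_measurable borel" "d2 \<in> borel_measurable borel"
    by (auto simp: d1_def [abs_def] d2_def [abs_def])
  have [measurable]: "(\<lambda>x. W1 r (x :: (real^'n) \<times> (real^'n))) \<in> borel_measurable (borel \<Otimes>\<^sub>M borel)"
    "(\<lambda>x. W2 r (x :: (real^'n) \<times> (real^'n))) \<in> borel_measurable (borel \<Otimes>\<^sub>M borel)"
    by (simp_all add: W1_def W2_def)
  interpret P: pair_sigma_finite "mvn (fst \<theta>) (\<sigma>1\<^sup>2)" "mvn (snd \<theta>) (\<sigma>2\<^sup>2)"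
    using s by (intro pair_sigma_finite.intro prob_space_imp_sigma_finite prob_space_mvn) auto
  have "(\<integral>\<^sup>+x. F (W1 r x, W2 r x) \<partial>law_X \<sigma>1 \<sigma>2 \<theta>)
      = (\<integral>\<^sup>+x2. \<integral>\<^sup>+x1. F (W1 r (x1, x2), W2 r (x1, x2)) \<partial>mvn (fst \<theta>) (\<sigma>1\<^sup>2) \<partial>mvn (snd \<theta>) (\<sigma>2\<^sup>2))"
    unfolding law_X_def by (rule P.nn_integral_snd [symmetric]) measurable
  also have "\<dots> = (\<integral>\<^sup>+x2. d2 x2 * (\<integral>\<^sup>+x1. d1 x1 * F (W1 r (x1, x2), W2 r (x1, x2)) \<partial>lborel) \<partial>lborel)"
    by (simp add: nn_integral_mvn d1_def d2_def rv)
  also have "\<dots> = (\<integral>\<^sup>+x2. d2 x2 * (\<integral>\<^sup>+w1. ennreal ((1 + r) ^ CARD('n))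
        * (d1 (x2 + (1 + r) *\<^sub>R w1) * F (w1, x2 + r *\<^sub>R w1)) \<partial>lborel) \<partial>lborel)"
  proof -
    have W1_eq: "W1 r (x2 + (1 + r) *\<^sub>R w1, x2) = w1" for w1 x2 :: "real^'n"
      using r1 by (simp add: W1_def)
    have W2_eq: "W2 r (x2 + (1 + r) *\<^sub>R w1, x2) = x2 + r *\<^sub>R w1" for w1 x2 :: "real^'n"
    proof -
      have "r *\<^sub>R (x2 + (1 + r) *\<^sub>R w1) + x2 = (1 + r) *\<^sub>R (x2 + r *\<^sub>R w1)"
        by (simp add: algebra_simps)
      then show ?thesis using r1 by (simp add: W2_def)
    qed
    have "(\<integral>\<^sup>+x1. d1 x1 * F (W1 r (x1, x2), W2 r (x1, x2)) \<partial>lborel)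
       = (\<integral>\<^sup>+w1. ennreal ((1 + r) ^ CARD('n))
        * (d1 (x2 + (1 + r) *\<^sub>R w1) * F (w1, x2 + r *\<^sub>R w1)) \<partial>lborel)" for x2
      by (subst nn_integral_lborel_affine [of _ "1 + r" x2])
         (use r1 in \<open>simp_all add: W1_eq W2_eq\<close>)
    then show ?thesis by simp
  qed
  also have "\<dots> = (\<integral>\<^sup>+x2. \<integral>\<^sup>+w1. d2 x2 * (ennreal ((1 + r) ^ CARD('n))
        * (d1 (x2 + (1 + r) *\<^sub>R w1) * F (w1, x2 + r *\<^sub>R w1))) \<partial>lborel \<partial>lborel)"
    by (simp add: nn_integral_cmult)
  also have "\<dots> = (\<integral>\<^sup>+w1. \<integral>\<^sup>+x2. d2 x2 * (ennreal ((1 + r) ^ CARD('n))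
        * (d1 (x2 + (1 + r) *\<^sub>R w1) * F (w1, x2 + r *\<^sub>R w1))) \<partial>lborel \<partial>lborel)"
    by (rule lborel_pair.Fubini') measurable
  also have "\<dots> = (\<integral>\<^sup>+w1. \<integral>\<^sup>+w2. d2 (w2 - r *\<^sub>R w1) * (ennreal ((1 + r) ^ CARD('n))
        * (d1 (w1 + w2) * F (w1, w2))) \<partial>lborel \<partial>lborel)"
  proof -
    have "(\<integral>\<^sup>+x2. d2 x2 * (ennreal ((1 + r) ^ CARD('n))
        * (d1 (x2 + (1 + r) *\<^sub>R w1) * F (w1, x2 + r *\<^sub>R w1))) \<partial>lborel)
      = (\<integral>\<^sup>+w2. d2 (w2 - r *\<^sub>R w1) * (ennreal ((1 + r) ^ CARD('n))
        * (d1 (w1 + w2) * F (w1, w2))) \<partial>lborel)" for w1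
      by (subst nn_integral_lborel_affine [of _ 1 "- r *\<^sub>R w1"]) (simp_all add: algebra_simps)
    then show ?thesis by simp
  qed
  also have "\<dots> = (\<integral>\<^sup>+w1. \<integral>\<^sup>+w2. ennreal (mvn_density \<mu>1 (?v / (1 + r)) w1)
        * (ennreal (mvn_density \<mu>2 (r * ?v / (1 + r)) w2) * F (w1, w2)) \<partial>lborel \<partial>lborel)"
  proof -
    have "d2 (w2 - r *\<^sub>R w1) * (ennreal ((1 + r) ^ CARD('n)) * d1 (w1 + w2))
      = ennreal (mvn_density \<mu>1 (?v / (1 + r)) w1)
        * ennreal (mvn_density \<mu>2 (r * ?v / (1 + r)) w2)" for w1 w2
      using r v mvn_density_prod_rotate [OF r v, of \<mu>1 \<mu>2 w1 w2]
      by (simp add: d1_def d2_def \<theta>1 \<theta>2 ennreal_mult [symmetric] mvn_density_pos less_imp_le mult_ac)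
    from arg_cong2 [where f="(*)", OF this refl, of _ _ "F (_, _)"] show ?thesis
      by (simp only: mult.assoc)
  qed
  also have "\<dots> = (\<integral>\<^sup>+w1. \<integral>\<^sup>+w2. F (w1, w2) \<partial>mvn \<mu>2 (r * ?v / (1 + r)) \<partial>mvn \<mu>1 (?v / (1 + r)))"
    by (subst nn_integral_mvn, measurable)+ (simp add: nn_integral_cmult)
  finally show ?thesis by (simp add: \<mu>1_def \<mu>2_def)
qed

section \<open>Predictive risk and squared-error risk\<close>

text \<open>The first summand is the part of the risk that no choice of \<open>\<psi>\<close> affects: the constant part of the loss
  and the variance of \<open>W2\<close>. It also does not depend on \<open>\<theta>\<close> when \<open>k\<close> and \<open>a\<close> do not.\<close>

lemma predictive_risk_affine:
  fixes \<psi> :: "real^'n \<Rightarrow> real^'n"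
  assumes s: "\<sigma>1 > 0" "\<sigma>2 > 0" and r_eq: "r = \<sigma>2\<^sup>2 / \<sigma>1\<^sup>2"
    and [measurable]: "\<psi> \<in> borel_measurable borel"
    and loss: "\<And>m. L (mvn_density (fst \<theta>) (\<sigma>Y\<^sup>2)) (mvn_density m (c * \<sigma>Y\<^sup>2))
        = k + a * ennreal ((norm (m - fst \<theta>))\<^sup>2)"
  shows "predictive_risk L \<sigma>1 \<sigma>2 \<sigma>Y \<theta> (q_plug \<sigma>Y c (delta r \<psi>))
       = (k + a * ennreal (real CARD('n) * (r * \<sigma>1\<^sup>2 / (1 + r))))
         + a * squared_error_risk (\<sigma>1\<^sup>2 / (1 + r)) (W1 r \<theta>) \<psi>"
proof -
  have r: "r > 0" and r1: "1 + r > 0"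
    using s by (simp_all add: r_eq add_pos_pos)
  define v1 v2 where "v1 = \<sigma>1\<^sup>2 / (1 + r)" and "v2 = r * \<sigma>1\<^sup>2 / (1 + r)"
  have v1: "v1 > 0" and v2: "v2 > 0" using s r by (simp_all add: v1_def v2_def)
  define \<mu>1 \<mu>2 where "\<mu>1 = W1 r \<theta>" and "\<mu>2 = W2 r \<theta>"
  have \<theta>1: "fst \<theta> = \<mu>1 + \<mu>2"
    using r1 fst_eq_W1_plus_W2 [of r \<theta>] by (simp add: \<mu>1_def \<mu>2_def)
  interpret M1: prob_space "mvn \<mu>1 v1" by (rule prob_space_mvn [OF v1])
  interpret M2: prob_space "mvn \<mu>2 v2" by (rule prob_space_mvn [OF v2])
  have inner: "(\<integral>\<^sup>+w2. k + a * ennreal ((norm (w2 + \<psi> w1 - fst \<theta>))\<^sup>2) \<partial>mvn \<mu>2 v2)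
      = (k + a * ennreal (real CARD('n) * v2)) + a * ennreal ((norm (\<psi> w1 - \<mu>1))\<^sup>2)" for w1
  proof -
    have "(\<integral>\<^sup>+w2. k + a * ennreal ((norm (w2 + \<psi> w1 - fst \<theta>))\<^sup>2) \<partial>mvn \<mu>2 v2)
        = (\<integral>\<^sup>+w2. k + a * ennreal ((norm (w2 - (fst \<theta> - \<psi> w1)))\<^sup>2) \<partial>mvn \<mu>2 v2)"
      by (simp add: algebra_simps)
    also have "\<dots> = k + a * ennreal (real CARD('n) * v2 + (norm (\<mu>2 - (fst \<theta> - \<psi> w1)))\<^sup>2)"
      by (simp add: nn_integral_add nn_integral_cmult nn_integral_mvn_second_moment [OF v2]
          M2.emeasure_space_1)
    also have "\<mu>2 - (fst \<theta> - \<psi> w1) = \<psi> w1 - \<mu>1"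
      by (simp add: \<theta>1)
    finally show ?thesis
      using v2 by (simp add: ennreal_plus distrib_left add.assoc)
  qed
  have "predictive_risk L \<sigma>1 \<sigma>2 \<sigma>Y \<theta> (q_plug \<sigma>Y c (delta r \<psi>))
      = (\<integral>\<^sup>+x. (\<lambda>(w1, w2). k + a * ennreal ((norm (w2 + \<psi> w1 - fst \<theta>))\<^sup>2)) (W1 r x, W2 r x)
          \<partial>law_X \<sigma>1 \<sigma>2 \<theta>)"
    by (simp add: predictive_risk_def q_plug_def loss delta_def)
  also have "\<dots> = (\<integral>\<^sup>+w1. \<integral>\<^sup>+w2. k + a * ennreal ((norm (w2 + \<psi> w1 - fst \<theta>))\<^sup>2)
      \<partial>mvn \<mu>2 v2 \<partial>mvn \<mu>1 v1)"
    by (subst nn_integral_law_X_W1_W2 [OF s r_eq]) (simp_all add: \<mu>1_def \<mu>2_def v1_def v2_def)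
  also have "\<dots> = (k + a * ennreal (real CARD('n) * v2)) + a * squared_error_risk v1 \<mu>1 \<psi>"
    by (simp add: inner nn_integral_add nn_integral_cmult M1.emeasure_space_1 squared_error_risk_def)
  finally show ?thesis by (simp add: v1_def v2_def \<mu>1_def)
qed

section \<open>Transfer of domination\<close>

lemma ennreal_affine_less_iff:
  fixes k a x y :: ennreal
  assumes "k < \<infinity>" and "0 < a" and "a < \<infinity>"
  shows "k + a * x < k + a * y \<longleftrightarrow> x < y"
  using assms ennreal_mult_le_mult_iff [of a y x]
  by (auto simp: ennreal_add_left_cancel_less not_le [symmetric])

text \<open>Domination is a statement about the order of the risks over the parameter space, hence invariant
  under a strictly increasing transformation of the risks and under a reparametrization that need
  only be onto: parameters with the same image have the same risks.\<close>

lemma dominates_affine_transfer: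
  assumes image: "g ` \<Theta> = \<Theta>'"
    and R: "\<And>\<theta> d. d \<in> {d1, d2} \<Longrightarrow> R \<theta> (h d) = k + a * R' (g \<theta>) d"
    and "k < \<infinity>" and "0 < a" and "a < \<infinity>"
  shows "dominates \<Theta> R (h d1) (h d2) \<longleftrightarrow> dominates \<Theta>' R' d1 d2"
  unfolding dominates_def image [symmetric]
  by (simp add: R ennreal_affine_less_iff [OF assms(3-5)] not_less [symmetric])

lemma W1_image_constraint:
  fixes A :: "(real^'n) set"
  assumes "1 + r \<noteq> 0"
  shows "W1 r ` {\<theta>. fst \<theta> - snd \<theta> \<in> A} = {\<mu>. (1 + r) *\<^sub>R \<mu> \<in> A}"
proof (intro equalityI subsetI)
  fix \<mu> assume "\<mu> \<in> {\<mu>. (1 + r) *\<^sub>R \<mu> \<in> A}"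
  \<comment> \<open>The risk does not see \<open>\<mu>2\<close>, so the preimage with \<open>\<theta>2 = 0\<close> serves.\<close>
  then have "((1 + r) *\<^sub>R \<mu>, 0) \<in> {\<theta>. fst \<theta> - snd \<theta> \<in> A}" and "\<mu> = W1 r ((1 + r) *\<^sub>R \<mu>, 0)"
    using assms by (simp_all add: W1_def)
  then show "\<mu> \<in> W1 r ` {\<theta>. fst \<theta> - snd \<theta> \<in> A}" by blast
qed (use assms in \<open>auto simp: W1_def\<close>)

theorem proposition3p1:
  fixes A :: "(real^'n) set"
    and \<sigma>1 \<sigma>2 \<sigma>Y r c :: real
    and \<psi>A \<psi>B :: "real^'n \<Rightarrow> real^'n"
    and L :: "(real^'n \<Rightarrow> real) \<Rightarrow> (real^'n \<Rightarrow> real) \<Rightarrow> ennreal"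
  assumes "\<sigma>1 > 0" and "\<sigma>2 > 0" and "\<sigma>Y > 0" and "c > 0"
    and "r = \<sigma>2\<^sup>2 / \<sigma>1\<^sup>2"
    and "\<psi>A \<in> borel_measurable borel" and "\<psi>B \<in> borel_measurable borel"
    and "L = KL_loss \<or> L = reverse_KL_loss"
  shows "dominates {\<theta>. fst \<theta> - snd \<theta> \<in> A} (predictive_risk L \<sigma>1 \<sigma>2 \<sigma>Y)
            (q_plug \<sigma>Y c (delta r \<psi>A)) (q_plug \<sigma>Y c (delta r \<psi>B))
         \<longleftrightarrow>
         dominates {\<mu>1. (1 + r) *\<^sub>R \<mu>1 \<in> A} (squared_error_risk (\<sigma>1\<^sup>2 / (1 + r))) \<psi>A \<psi>B"
proof -
  have v: "\<sigma>Y\<^sup>2 > 0" "c * \<sigma>Y\<^sup>2 > 0"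
    using assms(3,4) by simp_all
  have r1: "1 + r \<noteq> 0"
    using assms(1,2) by (simp add: assms(5) add_nonneg_eq_0_iff)
  obtain k a where ka: "0 < a" "a < \<infinity>" "k < \<infinity>"
    and loss: "\<And>m' m :: real^'n. L (mvn_density m' (\<sigma>Y\<^sup>2)) (mvn_density m (c * \<sigma>Y\<^sup>2))
        = k + a * ennreal ((norm (m - m'))\<^sup>2)"
    using assms(8)
  proof
    assume "L = KL_loss"
    then show thesis
      using v
      by (intro that [of "ennreal (1 / (2 * (c * \<sigma>Y\<^sup>2)))" "ennreal (kl_scale CARD('n) (\<sigma>Y\<^sup>2) (c * \<sigma>Y\<^sup>2))"])
         (simp_all only: KL_loss_def kl_div_mvn_density norm_minus_commute, auto)
  next
    assume "L = reverse_KL_loss"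
    then show thesis
      using v
      by (intro that [of "ennreal (1 / (2 * \<sigma>Y\<^sup>2))" "ennreal (kl_scale CARD('n) (c * \<sigma>Y\<^sup>2) (\<sigma>Y\<^sup>2))"])
         (simp_all only: reverse_KL_loss_def kl_div_mvn_density, auto)
  qed
  have "predictive_risk L \<sigma>1 \<sigma>2 \<sigma>Y \<theta> (q_plug \<sigma>Y c (delta r \<psi>))
      = (k + a * ennreal (real CARD('n) * (r * \<sigma>1\<^sup>2 / (1 + r))))
        + a * squared_error_risk (\<sigma>1\<^sup>2 / (1 + r)) (W1 r \<theta>) \<psi>"
    if "\<psi> \<in> {\<psi>A, \<psi>B}" for \<theta> \<psi>
    using that assms(6,7)
    by (intro predictive_risk_affine [OF assms(1,2,5)] loss) auto
  moreover have "k + a * ennreal (real CARD('n) * (r * \<sigma>1\<^sup>2 / (1 + r))) < \<infinity>"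
    using ka by (simp add: ennreal_mult_less_top)
  ultimately show ?thesis
    using ka by (intro dominates_affine_transfer [OF W1_image_constraint [OF r1],
          where h = "\<lambda>\<psi>. q_plug \<sigma>Y c (delta r \<psi>)"])
qed

end
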